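(* Let $M\subset\mathbb{R}^d$ be compact, convex and full $d$-dimensional, let $r\in\mathbb{N}$, and let $\varphi$ be the Vietoris-Rips filtration function $\varphi[J](x)=\max_{i,j\in J}\|x_i-x_j\|$. There is a constant $C_{VR}$ which only depends on $\operatorname{diam} M$ and $d$ such that for all $t\in[0,1]$ and all $J_1=\{i,j\}\neq\{k,\ell\}=J_2$ with $i,j,k,\ell\in[r]$, $$\lambda^{dr}\Big(\Big\{x\in M^r:\ \varphi[J_1](x)<\varphi[J_2](x)\ \text{ and }\ \varphi[J_1](y)\ge\varphi[J_2](y)\ \text{ for some } y\in B^{\otimes r}(x;t)\Big\}\Big)\le C_{VR}\,t .$$ In particular, there is a constant $C^*$, depending only on $r$, $d$ and $M$, such that $\lambda^{dr}(\{x\in M^r:\rho(x)\le t\})\le C^*t$ for all $t\in[0,1]$; more precisely, there is a constant $c$ depending only on $M$ and $d$ (not on $r$ or $t$) such that $$\lambda^{dr}(\{x\in M^r:\rho(x)\le t\})\le c\,r^4\,t\qquad\text{for all } t\in[0,1].$$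
   Context: $\lambda^{n}$ is $n$-dimensional Lebesgue measure, $\|\cdot\|$ the Euclidean norm, $[r]=\{1,\dots,r\}$, $\mathcal{F}_r$ the collection of nonempty subsets of $[r]$. For $x=(x_1,\dots,x_r)\in M^r$, $B^{\otimes r}(x;\epsilon)=\prod_{i=1}^r B(x_i;\epsilon)$ is the product of closed Euclidean $\epsilon$-balls; as $\varphi$ is defined on $M^r$, points $y\in B^{\otimes r}(x;\epsilon)$ are taken in $M^r$. The filtration function is $\varphi=(\varphi[J])_{J\in\mathcal{F}_r}:M^r\to\mathbb{R}^{2^r-1}$. For $x\in M^r$ let $u_1<\dots<u_{L^x}$ be the distinct values of $\varphi[J](x)$, $J\in\mathcal{F}_r$, and $E_l(x)=\{J\in\mathcal{F}_r:\varphi[J](x)=u_l\}$. $J_l^x$ denotes the inclusion-minimal element of $E_l(x)$ (if it is not unique, $J_l^x$ is understood as the collection of inclusion-minimal elements of $E_l(x)$). The stability functional is $$\rho(x)=\sup\{\epsilon\ge0:\ \text{for all } y\in B^{\otimes r}(x;\epsilon):\ L^x=L^y\text{ and }J_i^x=J_i^y\text{ for }1\le i\le L^x\}$$ (with $\rho(x)=\infty$ if the set is unbounded).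
   Formalization: The bounds with C_VR and c r^4 carry an extra factor max(1, vol M)^r: constants independent of r are impossible when vol M > 1 (e.g. M=[0,2], t=1, where the sets have measure at least 2^r/1024); for vol M ≤ 1 the bounds are as stated. *)

theory Defs
  imports "HOL-Analysis.Analysis"
begin

text \<open>
  A point of \<open>M\<^sup>r\<close> is an extensional function on the index set \<open>{1..r}\<close>.  This keeps \<open>r\<close> an
  ordinary natural number, so that uniformity of a constant in \<open>r\<close> can be expressed.
\<close>

definition power_set_pts :: "'a set \<Rightarrow> nat \<Rightarrow> (nat \<Rightarrow> 'a) set" where
  "power_set_pts M r = ({1..r} \<rightarrow>\<^sub>E M)"

definition lebesgue_power :: "nat \<Rightarrow> (nat \<Rightarrow> 'a::euclidean_space) measure" where
  "lebesgue_power r = (\<Pi>\<^sub>M i\<in>{1..r}. lborel)"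

definition ball_prod :: "'a::metric_space set \<Rightarrow> nat \<Rightarrow> (nat \<Rightarrow> 'a) \<Rightarrow> real \<Rightarrow> (nat \<Rightarrow> 'a) set" where
  "ball_prod M r x \<epsilon> = {y \<in> power_set_pts M r. \<forall>i\<in>{1..r}. y i \<in> cball (x i) \<epsilon>}"

definition faces :: "nat \<Rightarrow> nat set set" where
  "faces r = Pow {1..r} - {{}}"

definition vr :: "nat set \<Rightarrow> (nat \<Rightarrow> 'a::real_normed_vector) \<Rightarrow> real" where
  "vr J x = (MAX (i, j)\<in>J \<times> J. norm (x i - x j))"

text \<open>The following notions make sense for an arbitrary family \<open>\<phi>\<close> of filtration functions.\<close>

definition filt_values :: "(nat set \<Rightarrow> (nat \<Rightarrow> 'a) \<Rightarrow> real) \<Rightarrow> nat \<Rightarrow> (nat \<Rightarrow> 'a) \<Rightarrow> real set" where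
  "filt_values \<phi> r x = (\<lambda>J. \<phi> J x) ` faces r"

definition num_levels :: "(nat set \<Rightarrow> (nat \<Rightarrow> 'a) \<Rightarrow> real) \<Rightarrow> nat \<Rightarrow> (nat \<Rightarrow> 'a) \<Rightarrow> nat" where
  "num_levels \<phi> r x = card (filt_values \<phi> r x)"

text \<open>Levels are numbered \<open>1, \<dots>, num_levels \<phi> r x\<close>, whereas list positions start at \<open>0\<close>.\<close>

definition level_value :: "(nat set \<Rightarrow> (nat \<Rightarrow> 'a) \<Rightarrow> real) \<Rightarrow> nat \<Rightarrow> (nat \<Rightarrow> 'a) \<Rightarrow> nat \<Rightarrow> real" where
  "level_value \<phi> r x l = sorted_list_of_set (filt_values \<phi> r x) ! (l - 1)"

definition level_set :: "(nat set \<Rightarrow> (nat \<Rightarrow> 'a) \<Rightarrow> real) \<Rightarrow> nat \<Rightarrow> (nat \<Rightarrow> 'a) \<Rightarrow> nat \<Rightarrow> nat set set" where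
  "level_set \<phi> r x l = {J \<in> faces r. \<phi> J x = level_value \<phi> r x l}"

text \<open>
  Always the collection of all inclusion-minimal elements; a unique minimal element \<open>J\<close> is
  represented by \<open>{J}\<close>.
\<close>

definition minimal_faces ::
    "(nat set \<Rightarrow> (nat \<Rightarrow> 'a) \<Rightarrow> real) \<Rightarrow> nat \<Rightarrow> (nat \<Rightarrow> 'a) \<Rightarrow> nat \<Rightarrow> nat set set" where
  "minimal_faces \<phi> r x l =
     {J \<in> level_set \<phi> r x l. \<forall>K \<in> level_set \<phi> r x l. K \<subseteq> J \<longrightarrow> K = J}"

text \<open>Valued in the extended reals, so the supremum of an unbounded set is \<open>\<infinity>\<close>.\<close>

definition stability ::
    "(nat set \<Rightarrow> (nat \<Rightarrow> 'a::metric_space) \<Rightarrow> real) \<Rightarrow> 'a set \<Rightarrow> nat \<Rightarrow> (nat \<Rightarrow> 'a) \<Rightarrow> ereal" where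
  "stability \<phi> M r x =
     Sup (ereal ` {\<epsilon>. 0 \<le> \<epsilon> \<and>
       (\<forall>y\<in>ball_prod M r x \<epsilon>. num_levels \<phi> r x = num_levels \<phi> r y \<and>
          (\<forall>i\<in>{1..num_levels \<phi> r x}. minimal_faces \<phi> r x i = minimal_faces \<phi> r y i))})"

definition inversion_set ::
    "(nat set \<Rightarrow> (nat \<Rightarrow> 'a::metric_space) \<Rightarrow> real) \<Rightarrow> 'a set \<Rightarrow> nat \<Rightarrow> nat set \<Rightarrow> nat set \<Rightarrow> real
      \<Rightarrow> (nat \<Rightarrow> 'a) set" where
  "inversion_set \<phi> M r J\<^sub>1 J\<^sub>2 t =
     {x \<in> power_set_pts M r. \<phi> J\<^sub>1 x < \<phi> J\<^sub>2 x \<and> (\<exists>y\<in>ball_prod M r x t. \<phi> J\<^sub>1 y \<ge> \<phi> J\<^sub>2 y)}"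

definition unstable_set ::
    "(nat set \<Rightarrow> (nat \<Rightarrow> 'a::metric_space) \<Rightarrow> real) \<Rightarrow> 'a set \<Rightarrow> nat \<Rightarrow> real \<Rightarrow> (nat \<Rightarrow> 'a) set" where
  "unstable_set \<phi> M r t = {x \<in> power_set_pts M r. stability \<phi> M r x \<le> ereal t}"

text \<open>
  Measurability is part of the claim, since \<open>emeasure\<close> is \<open>0\<close> on non-measurable sets.
\<close>

definition volume_le :: "nat \<Rightarrow> (nat \<Rightarrow> 'a::euclidean_space) set \<Rightarrow> real \<Rightarrow> bool" where
  "volume_le r A b \<longleftrightarrow>
     A \<in> sets (lebesgue_power r) \<and> emeasure (lebesgue_power r) A \<le> ennreal b"

definition convex_body :: "(real ^ 'n) set \<Rightarrow> bool" where
  "convex_body M \<longleftrightarrow> compact M \<and> convex M \<and> aff_dim M = int CARD('n)"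

text \<open>
  Equal to \<open>1\<close> if \<open>M\<close> has volume at most \<open>1\<close>.  For larger \<open>M\<close> the \<open>r\<close>-fold Lebesgue measure
  scales like the \<open>r\<close>-th power of the volume of \<open>M\<close>, and no bound with constants independent of
  \<open>r\<close> can hold without such a factor.  For instance let \<open>M = [0,2]\<close>, \<open>t = 1\<close> and \<open>r \<ge> 4\<close>.  If
  \<open>x\<^sub>1, x\<^sub>2\<close> are distinct points of \<open>(0,1/2)\<close>, \<open>x\<^sub>3\<close> is in \<open>(0,1/4)\<close> and \<open>x\<^sub>4\<close> is in
  \<open>(3/4,1)\<close>, then moving \<open>x\<^sub>4\<close> onto \<open>x\<^sub>3\<close> shows that \<open>x\<close> lies both in the inversion set of
  \<open>{1,2}\<close> and \<open>{3,4}\<close> and in the unstable set.  Such \<open>x\<close> have measure \<open>2\<^sup>r / 1024\<close>.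
\<close>

definition volume_factor :: "(real ^ 'n) set \<Rightarrow> nat \<Rightarrow> real" where
  "volume_factor M r = max 1 (measure lborel M) ^ r"

end

theory Submission
  imports Defs
begin

text \<open>
  The order of the edge lengths \<open>norm (x i - x j)\<close> determines the order of all values \<open>vr J x\<close>, hence
  the levels and their minimal faces.  Moving every point by at most \<open>t\<close> changes each edge length by
  at most \<open>2 * t\<close>, so an inversion or an instability at scale \<open>t\<close> forces two edges whose lengths
  differ by at most \<open>4 * t\<close>.  Of two distinct edges the longer one has an endpoint which is not an
  endpoint of the shorter one; once all other points are fixed, this endpoint lies in a spherical
  shell of width \<open>4 * t\<close>, and Fubini gives the bound.
\<close>

section \<open>Levels depend only on the order of the filtration values\<close>

lemma sorted_list_of_set_image_strict_mono_on:
  fixes h :: "'a::linorder \<Rightarrow> 'b::linorder"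
  assumes "finite V" "strict_mono_on V h"
  shows "sorted_list_of_set (h ` V) = map h (sorted_list_of_set V)"
proof (rule sorted_distinct_set_unique)
  have "inj_on h V"
    using assms(2) by (rule strict_mono_on_imp_inj_on)
  then show "distinct (map h (sorted_list_of_set V))"
    using assms(1) by (simp add: distinct_map)
  have "mono_on V h"
    using assms(2) by (rule strict_mono_on_imp_mono_on)
  then show "sorted (map h (sorted_list_of_set V))"
    unfolding sorted_map using assms(1)
    by - (rule sorted_wrt_mono_rel[OF _ sorted_sorted_list_of_set], simp add: mono_on_def)
  show "set (sorted_list_of_set (h ` V)) = set (map h (sorted_list_of_set V))"
    using assms(1) by simp
qed simp_all

lemma finite_faces: "finite (faces r)"
  by (simp add: faces_def)

text \<open>Sending the value of a face at \<open>x\<close> to its value at \<open>y\<close> is a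
  well-defined order isomorphism between the two sets of values. It preserves positions in the
  sorted lists, so equally numbered levels contain the same faces.\<close>

lemma same_order_imp_same_levels:
  assumes order: "\<And>J K. J \<in> faces r \<Longrightarrow> K \<in> faces r \<Longrightarrow> \<phi> J x \<le> \<phi> K x \<longleftrightarrow> \<phi> J y \<le> \<phi> K y"
  shows "num_levels \<phi> r x = num_levels \<phi> r y"
    and "l \<in> {1..num_levels \<phi> r x} \<Longrightarrow> minimal_faces \<phi> r x l = minimal_faces \<phi> r y l"
proof -
  define V where "V = filt_values \<phi> r x"
  \<comment> \<open>Several faces may attain \<open>v\<close>. The order hypothesis, used in both
    directions, shows that all of them have the same value at \<open>y\<close>, so the choice does
    not matter.\<close>
  define h where "h v = \<phi> (SOME J. J \<in> faces r \<and> \<phi> J x = v) y" for v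
  have h: "h (\<phi> J x) = \<phi> J y" if "J \<in> faces r" for J
  proof -
    define K where "K = (SOME K. K \<in> faces r \<and> \<phi> K x = \<phi> J x)"
    have K: "K \<in> faces r \<and> \<phi> K x = \<phi> J x"
      unfolding K_def by (rule someI[of _ J]) (simp add: that)
    then have "\<phi> K y = \<phi> J y"
      using order[OF that, of K] order[of K J] that by auto
    then show ?thesis
      by (simp add: h_def K_def)
  qed
  have fin: "finite V"
    by (simp add: V_def filt_values_def finite_faces)
  have image: "filt_values \<phi> r y = h ` V"
    by (auto simp: V_def filt_values_def image_image h)
  have "strict_mono_on V h"
  proof (rule strict_mono_onI)
    fix u v assume uv: "u \<in> V" "v \<in> V" "u < v"
    then obtain J K where "J \<in> faces r" "K \<in> faces r" "u = \<phi> J x" "v = \<phi> K x"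
      by (auto simp: V_def filt_values_def)
    with uv(3) order[of K J] show "h u < h v"
      by (simp add: h not_le[symmetric])
  qed
  note mono = this
  have inj: "inj_on h V"
    using mono by (rule strict_mono_on_imp_inj_on)
  show L: "num_levels \<phi> r x = num_levels \<phi> r y"
    unfolding num_levels_def image by (simp add: V_def[symmetric] card_image[OF inj])
  assume l: "l \<in> {1..num_levels \<phi> r x}"
  \<comment> \<open>Levels start at 1, so \<open>l - 1\<close> is a valid list position.\<close>
  then have len: "l - 1 < length (sorted_list_of_set V)"
    using fin by (auto simp: num_levels_def V_def[symmetric])
  have level_y: "level_value \<phi> r y l = h (level_value \<phi> r x l)"
    unfolding level_value_def image sorted_list_of_set_image_strict_mono_on[OF fin mono]
    using len by (simp add: V_def[symmetric])
  have level_x: "level_value \<phi> r x l \<in> V"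
    using nth_mem[OF len] fin by (simp add: level_value_def V_def[symmetric])
  have "level_set \<phi> r x l = level_set \<phi> r y l"
    unfolding level_set_def
  proof (intro Collect_cong conj_cong refl)
    fix J assume J: "J \<in> faces r"
    then have "\<phi> J x \<in> V"
      by (auto simp: V_def filt_values_def)
    then show "(\<phi> J x = level_value \<phi> r x l) = (\<phi> J y = level_value \<phi> r y l)"
      unfolding level_y h[OF J, symmetric] using level_x inj by (auto simp: inj_on_def)
  qed
  then show "minimal_faces \<phi> r x l = minimal_faces \<phi> r y l"
    by (simp add: minimal_faces_def)
qed

section \<open>Edge lengths\<close>

text \<open>Degenerate edges \<open>i = j\<close> are included, so the relation also records which
  points coincide.\<close>

definition same_edge_order :: "nat \<Rightarrow> (nat \<Rightarrow> 'a::real_normed_vector) \<Rightarrow> (nat \<Rightarrow> 'a) \<Rightarrow> bool" where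
  "same_edge_order r x y \<longleftrightarrow> (\<forall>i\<in>{1..r}. \<forall>j\<in>{1..r}. \<forall>k\<in>{1..r}. \<forall>l\<in>{1..r}.
     norm (x i - x j) \<le> norm (x k - x l) \<longleftrightarrow> norm (y i - y j) \<le> norm (y k - y l))"

lemma vr_edge: "vr {i, j} x = norm (x i - x j)"
proof -
  have "(\<lambda>(i, j). norm (x i - x j)) ` ({i, j} \<times> {i, j}) = {0, norm (x i - x j)}"
    by (auto simp: norm_minus_commute image_iff)
  then show ?thesis
    by (simp add: vr_def)
qed

text \<open>Maxima over finite nonempty sets turn into quantifiers. A comparison of two filtration
  values thus becomes a Boolean combination of comparisons of edge lengths.\<close>

lemma vr_le_iff:
  assumes "J \<in> faces r" "K \<in> faces r"
  shows "vr J x \<le> vr K x \<longleftrightarrow>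
    (\<forall>i\<in>J. \<forall>j\<in>J. \<exists>k\<in>K. \<exists>l\<in>K. norm (x i - x j) \<le> norm (x k - x l))"
proof -
  have "finite J" "J \<noteq> {}" "finite K" "K \<noteq> {}"
    using assms by (auto simp: faces_def intro: finite_subset)
  then have le: "vr J x \<le> c \<longleftrightarrow> (\<forall>i\<in>J. \<forall>j\<in>J. norm (x i - x j) \<le> c)"
    and ge: "c \<le> vr K x \<longleftrightarrow> (\<exists>k\<in>K. \<exists>l\<in>K. c \<le> norm (x k - x l))" for c
    by (auto simp: vr_def Max_ge_iff)
  show ?thesis
    unfolding le unfolding ge ..
qed

lemma same_edge_order_imp_vr_le_iff:
  assumes "same_edge_order r x y" and JK: "J \<in> faces r" "K \<in> faces r"
  shows "vr J x \<le> vr K x \<longleftrightarrow> vr J y \<le> vr K y"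
  unfolding vr_le_iff[OF JK]
proof (intro ball_cong bex_cong refl)
  fix i j k l assume "i \<in> J" "j \<in> J" "k \<in> K" "l \<in> K"
  moreover have "J \<subseteq> {1..r}" "K \<subseteq> {1..r}"
    using JK by (auto simp: faces_def)
  ultimately show "(norm (x i - x j) \<le> norm (x k - x l)) = (norm (y i - y j) \<le> norm (y k - y l))"
    using assms(1) unfolding same_edge_order_def by (meson subsetD)
qed

lemma edge_length_diff_le:
  assumes "y \<in> ball_prod M r x \<epsilon>" "i \<in> {1..r}" "j \<in> {1..r}"
  shows "\<bar>norm (x i - x j) - norm (y i - y j)\<bar> \<le> 2 * \<epsilon>"
proof -
  have "norm (x i - y i) \<le> \<epsilon>" "norm (x j - y j) \<le> \<epsilon>"
    using assms by (auto simp: ball_prod_def dist_norm)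
  moreover have "\<bar>norm (x i - x j) - norm (y i - y j)\<bar> \<le> norm ((x i - y i) - (x j - y j))"
    using norm_triangle_ineq3[of "x i - x j" "y i - y j"] by (simp add: algebra_simps)
  ultimately show ?thesis
    using norm_triangle_ineq4[of "x i - y i" "x j - y j"] by linarith
qed

text \<open>Each of the two lengths changes by at most \<open>2 * \<epsilon>\<close>, so a gap above
  \<open>4 * \<epsilon>\<close> cannot be reversed. In \<open>gap\<close> the shorter edge may be
  degenerate, which makes every proper edge longer than \<open>4 * \<epsilon>\<close>; the longer
  one may not, since two degenerate edges both have length 0.\<close>

lemma separated_edges_imp_same_order:
  assumes y: "y \<in> ball_prod M r x \<epsilon>" and "0 \<le> \<epsilon>"
    and gap: "\<And>i j k l. i \<in> {1..r} \<Longrightarrow> j \<in> {1..r} \<Longrightarrow> k \<in> {1..r} \<Longrightarrow> l \<in> {1..r} \<Longrightarrow>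
      {i, j} \<noteq> {k, l} \<Longrightarrow> k \<noteq> l \<Longrightarrow> norm (x i - x j) \<le> norm (x k - x l) \<Longrightarrow>
      norm (x i - x j) + 4 * \<epsilon> < norm (x k - x l)"
  shows "same_edge_order r x y"
  unfolding same_edge_order_def
proof (intro ballI)
  fix i j k l assume ran: "i \<in> {1..r}" "j \<in> {1..r}" "k \<in> {1..r}" "l \<in> {1..r}"
  note close = edge_length_diff_le[OF y ran(1,2)] edge_length_diff_le[OF y ran(3,4)]
  consider "{i, j} = {k, l}" | "{i, j} \<noteq> {k, l}" "i = j" | "{i, j} \<noteq> {k, l}" "i \<noteq> j" "k = l"
    | "{i, j} \<noteq> {k, l}" "i \<noteq> j" "k \<noteq> l"
    by blast
  then show "(norm (x i - x j) \<le> norm (x k - x l)) = (norm (y i - y j) \<le> norm (y k - y l))"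
  proof cases
    case 1
    then show ?thesis
      by (auto simp: doubleton_eq_iff norm_minus_commute)
  next
    case 2
    then show ?thesis by simp
  next
    \<comment> \<open>The degenerate edge at \<open>k\<close> serves as the shorter edge in
      \<open>gap\<close>. The other edge then keeps positive length at \<open>y\<close>, and both
      comparisons are false.\<close>
    case 3
    then have "norm (x i - x j) > 4 * \<epsilon>"
      using gap[of k l i j] ran by auto
    with close \<open>0 \<le> \<epsilon>\<close> \<open>k = l\<close> show ?thesis
      by auto
  next
    case 4
    show ?thesis
    proof (cases "norm (x i - x j) \<le> norm (x k - x l)")
      case True
      with gap[OF ran 4(1,3)] close show ?thesis by linarith
    next
      case False
      then have "norm (x k - x l) + 4 * \<epsilon> < norm (x i - x j)"
        using gap[of k l i j] ran 4 by auto
      with close False show ?thesis by linarith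
    qed
  qed
qed

section \<open>Volume of the set of almost equal edge lengths\<close>

text \<open>The factor 4 lets each of the two lengths change by \<open>2 * t\<close>. Both
  inequalities are non-strict, so outside the shells the gaps are strict and survive a slight
  increase of \<open>t\<close>.\<close>

definition edge_shell ::
    "'a::real_normed_vector set \<Rightarrow> nat \<Rightarrow> nat \<Rightarrow> nat \<Rightarrow> nat \<Rightarrow> nat \<Rightarrow> real \<Rightarrow> (nat \<Rightarrow> 'a) set" where
  "edge_shell M r i j k l t = {x \<in> power_set_pts M r.
     norm (x i - x j) \<le> norm (x k - x l) \<and> norm (x k - x l) \<le> norm (x i - x j) + 4 * t}"

text \<open>Concentric balls of radii \<open>a \<le> b\<close> in dimension \<open>d\<close> differ
  in volume by at most \<open>d * b ^ (d - 1) * (b - a)\<close> unit balls. Here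
  \<open>b - a = 4 * t\<close>, and \<open>b \<le> D + 4\<close> because
  \<open>t \<le> 1\<close>.\<close>

definition shell_const :: "nat \<Rightarrow> real \<Rightarrow> real" where
  "shell_const d D = 4 * unit_ball_vol (real d) * real d * (D + 4) ^ (d - 1)"

lemma shell_const_nonneg: "0 \<le> D \<Longrightarrow> 0 \<le> shell_const d D"
  by (simp add: shell_const_def)

text \<open>A mean value estimate, by induction; it makes the volume of a shell linear in its
  width.\<close>

lemma power_diff_le_mult:
  fixes a b :: real
  assumes "0 \<le> a" "a \<le> b"
  shows "b ^ n - a ^ n \<le> real n * b ^ (n - 1) * (b - a)"
proof (induction n)
  case (Suc n)
  have "b ^ Suc n - a ^ Suc n = b * (b ^ n - a ^ n) + a ^ n * (b - a)"
    by (simp add: algebra_simps)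
  also have "\<dots> \<le> b * (real n * b ^ (n - 1) * (b - a)) + b ^ n * (b - a)"
    using assms Suc by (intro add_mono mult_left_mono mult_right_mono power_mono) auto
  \<comment> \<open>The case \<open>n = 0\<close> is separate because of the truncated exponent
    \<open>n - 1\<close>; the term containing it then has coefficient 0.\<close>
  also have "\<dots> = real (Suc n) * b ^ (Suc n - 1) * (b - a)"
    by (cases n) (auto simp: algebra_simps)
  finally show ?case .
qed simp

text \<open>Removing the open ball keeps the inner sphere, in accordance with the non-strict
  inequalities of \<open>edge_shell\<close>.\<close>

lemma emeasure_spherical_shell_le:
  fixes c :: "'a::euclidean_space"
  assumes "0 \<le> a" "a \<le> D" "0 \<le> t" "t \<le> 1"
  shows "emeasure lborel (cball c (a + 4 * t) - ball c a) \<le> ennreal (shell_const DIM('a) D * t)"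
proof -
  let ?d = "DIM('a)" and ?v = "unit_ball_vol (real DIM('a))"
  have v: "0 \<le> ?v" by simp
  have "emeasure lborel (cball c (a + 4 * t) - ball c a)
      = emeasure lborel (cball c (a + 4 * t)) - emeasure lborel (ball c a)"
    using assms by (intro emeasure_Diff) (auto simp: emeasure_ball)
  also have "\<dots> = ennreal (?v * ((a + 4 * t) ^ ?d - a ^ ?d))"
    using assms by (simp add: emeasure_ball emeasure_cball ennreal_minus right_diff_distrib)
  also have "\<dots> \<le> ennreal (shell_const ?d D * t)"
  proof (rule ennreal_leI)
    have "(a + 4 * t) ^ ?d - a ^ ?d \<le> real ?d * (a + 4 * t) ^ (?d - 1) * (4 * t)"
      using power_diff_le_mult[of a "a + 4 * t" ?d] assms by simp
    also have "\<dots> \<le> real ?d * (D + 4) ^ (?d - 1) * (4 * t)"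
      using assms by (intro mult_right_mono mult_left_mono power_mono) auto
    finally show "?v * ((a + 4 * t) ^ ?d - a ^ ?d) \<le> shell_const ?d D * t"
      using mult_left_mono[OF _ v] by (fastforce simp: shell_const_def mult_ac)
  qed
  finally show ?thesis .
qed

section \<open>Measurability of coordinates, edge lengths and edge shells\<close>

lemma space_lebesgue_power: "space (lebesgue_power r) = {1..r} \<rightarrow>\<^sub>E UNIV"
  by (simp add: lebesgue_power_def space_PiM)

lemma power_set_pts_subset_space: "power_set_pts M r \<subseteq> space (lebesgue_power r)"
  by (auto simp: power_set_pts_def space_lebesgue_power)

lemma power_set_pts_sets:
  "M \<in> sets borel \<Longrightarrow> power_set_pts M r \<in> sets (lebesgue_power r)"
  unfolding power_set_pts_def lebesgue_power_def by (intro sets_PiM_I_finite) auto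

lemma measurable_lebesgue_power_coordinate:
  "i \<in> {1..r} \<Longrightarrow> (\<lambda>x. x i) \<in> borel_measurable (lebesgue_power r)"
  unfolding lebesgue_power_def
  by (rule measurable_component_singleton[where M = "\<lambda>_. lborel", unfolded measurable_lborel1])

lemma measurable_edge_length:
  "i \<in> {1..r} \<Longrightarrow> j \<in> {1..r} \<Longrightarrow>
    (\<lambda>x. norm (x i - x j :: 'a::euclidean_space)) \<in> borel_measurable (lebesgue_power r)"
  by (intro measurable_compose[OF _ borel_measurable_norm] borel_measurable_diff
      measurable_lebesgue_power_coordinate)

lemma edge_shell_sets:
  fixes M :: "'a::euclidean_space set"
  assumes "M \<in> sets borel" and ran: "i \<in> {1..r}" "j \<in> {1..r}" "k \<in> {1..r}" "l \<in> {1..r}"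
  shows "edge_shell M r i j k l t \<in> sets (lebesgue_power r)"
proof -
  have "edge_shell M r i j k l t = power_set_pts M r \<inter> {x \<in> space (lebesgue_power r).
      norm (x i - x j) \<le> norm (x k - x l) \<and> norm (x k - x l) \<le> norm (x i - x j) + 4 * t}"
    using power_set_pts_subset_space by (fastforce simp: edge_shell_def)
  also have "\<dots> \<in> sets (lebesgue_power r)"
    by (intro sets.Int power_set_pts_sets assms(1) sets.sets_Collect_conj borel_measurable_le
        borel_measurable_add borel_measurable_const measurable_edge_length ran)
  finally show ?thesis .
qed

text \<open>Coordinate \<open>k\<close> is integrated first. With the others fixed, it ranges over a
  shell around \<open>x l\<close> whose inner radius, the length of the edge from \<open>i\<close>
  to \<open>j\<close>, is at most the diameter. The remaining \<open>r - 1\<close> coordinates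
  contribute a power of the volume of \<open>M\<close>.\<close>

lemma emeasure_edge_shell_le_aux:
  fixes M :: "'a::euclidean_space set"
  assumes M: "compact M" and ran: "i \<in> {1..r}" "j \<in> {1..r}" "k \<in> {1..r}" "l \<in> {1..r}"
    and k: "k \<notin> {i, j, l}" and t: "0 \<le> t" "t \<le> 1"
  shows "emeasure (lebesgue_power r) (edge_shell M r i j k l t)
    \<le> ennreal (shell_const DIM('a) (diameter M) * max 1 (measure lborel M) ^ r * t)"
proof -
  interpret product_sigma_finite "\<lambda>_::nat. lborel :: 'a measure" ..
  let ?A = "edge_shell M r i j k l t"
  define I where "I = {1..r} - {k}"
  define K where "K = shell_const DIM('a) (diameter M) * t"
  have K: "0 \<le> K"
    using t M by (simp add: K_def shell_const_nonneg diameter_ge_0 compact_imp_bounded)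
  have I: "finite I" "k \<notin> I" "insert k I = {1..r}" "card I = r - 1"
    using ran by (auto simp: I_def)
  have Mb: "M \<in> sets borel"
    using M by (simp add: borel_compact)
  have A: "?A \<in> sets (\<Pi>\<^sub>M i\<in>insert k I. lborel)"
    using edge_shell_sets[OF Mb ran] by (simp add: I lebesgue_power_def)
  have "emeasure (lebesgue_power r) ?A = (\<integral>\<^sup>+x. indicator ?A x \<partial>(\<Pi>\<^sub>M i\<in>insert k I. lborel))"
    using A by (simp add: I lebesgue_power_def)
  also have "\<dots> = (\<integral>\<^sup>+x. (\<integral>\<^sup>+y. indicator ?A (x(k := y)) \<partial>lborel) \<partial>(\<Pi>\<^sub>M i\<in>I. lborel))"
    using I A by (intro product_nn_integral_insert) auto
  also have "\<dots> \<le> (\<integral>\<^sup>+x. ennreal K * indicator (I \<rightarrow>\<^sub>E M) x \<partial>(\<Pi>\<^sub>M i\<in>I. lborel))"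
  proof (rule nn_integral_mono)
    fix x :: "nat \<Rightarrow> 'a" assume "x \<in> space (\<Pi>\<^sub>M i\<in>I. lborel)"
    then have x: "x \<in> extensional I"
      by (simp add: space_PiM PiE_def)
    show "(\<integral>\<^sup>+y. indicator ?A (x(k := y)) \<partial>lborel) \<le> ennreal K * indicator (I \<rightarrow>\<^sub>E M) x"
    proof (cases "x \<in> I \<rightarrow>\<^sub>E M")
      case True
      let ?a = "norm (x i - x j)"
      have "i \<in> I" "j \<in> I"
        using ran k by (auto simp: I_def)
      with True have "dist (x i) (x j) \<le> diameter M"
        using M by (intro diameter_bounded_bound compact_imp_bounded) auto
      then have "emeasure lborel (cball (x l) (?a + 4 * t) - ball (x l) ?a) \<le> ennreal K"
        unfolding K_def using t by (intro emeasure_spherical_shell_le) (auto simp: dist_norm)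
      \<comment> \<open>Since \<open>k\<close> differs from \<open>i\<close>, \<open>j\<close> and
        \<open>l\<close>, the update at \<open>k\<close> changes neither the centre nor the radii.
        The condition that \<open>y\<close> lies in \<open>M\<close> is dropped.\<close>
      moreover have "(\<integral>\<^sup>+y. indicator ?A (x(k := y)) \<partial>lborel)
          \<le> (\<integral>\<^sup>+y. indicator (cball (x l) (?a + 4 * t) - ball (x l) ?a) y \<partial>lborel)"
        using k by (intro nn_integral_mono)
          (auto simp: edge_shell_def indicator_def dist_norm norm_minus_commute)
      ultimately show ?thesis
        using True by simp
    next
      \<comment> \<open>If a coordinate in \<open>I\<close> lies outside \<open>M\<close>, no value
        at \<open>k\<close> can repair this, so the inner integral vanishes. Extensionality of
        \<open>x\<close> reduces the failure to such a coordinate.\<close>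
      case False
      have "x(k := y) \<notin> ?A" for y
      proof
        assume "x(k := y) \<in> ?A"
        then have "x(k := y) \<in> {1..r} \<rightarrow>\<^sub>E M"
          by (simp add: edge_shell_def power_set_pts_def)
        then have "x m \<in> M" if "m \<in> I" for m
          using PiE_mem[of "x(k := y)" "{1..r}" "\<lambda>_. M" m] that by (simp add: I_def)
        with x False show False
          by (simp add: PiE_iff)
      qed
      then show ?thesis by simp
    qed
  qed
  also have "\<dots> = ennreal K * emeasure (\<Pi>\<^sub>M i\<in>I. lborel) (I \<rightarrow>\<^sub>E M)"
    using I Mb by (intro nn_integral_cmult_indicator sets_PiM_I_finite) auto
  also have "\<dots> = ennreal K * emeasure lborel M ^ (r - 1)"
    using I Mb by (subst emeasure_PiM) auto
  also have "emeasure lborel M = ennreal (measure lborel M)"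
    using emeasure_compact_finite[OF M] by (intro emeasure_eq_ennreal_measure) auto
  also have "ennreal K * ennreal (measure lborel M) ^ (r - 1) = ennreal (K * measure lborel M ^ (r - 1))"
    using K by (simp add: ennreal_power ennreal_mult)
  \<comment> \<open>Passing from exponent \<open>r - 1\<close> to \<open>r\<close> needs a base of
    at least 1, whence the maximum.\<close>
  also have "\<dots> \<le> ennreal (K * max 1 (measure lborel M) ^ r)"
  proof (intro ennreal_leI mult_left_mono K)
    have "measure lborel M ^ (r - 1) \<le> max 1 (measure lborel M) ^ (r - 1)"
      by (intro power_mono) auto
    also have "\<dots> \<le> max 1 (measure lborel M) ^ r"
      by (intro power_increasing) auto
    finally show "measure lborel M ^ (r - 1) \<le> max 1 (measure lborel M) ^ r" .
  qed
  finally show ?thesis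
    by (simp add: K_def mult_ac)
qed

text \<open>Were both \<open>k\<close> and \<open>l\<close> in \<open>{i, j}\<close>, the two edges
  would coincide as \<open>k \<noteq> l\<close>. So one of them is a free endpoint, and the shell is
  symmetric in \<open>k\<close> and \<open>l\<close>.\<close>

lemma emeasure_edge_shell_le:
  fixes M :: "'a::euclidean_space set"
  assumes M: "compact M" and ran: "i \<in> {1..r}" "j \<in> {1..r}" "k \<in> {1..r}" "l \<in> {1..r}"
    and ne: "{i, j} \<noteq> {k, l}" "k \<noteq> l" and t: "0 \<le> t" "t \<le> 1"
  shows "emeasure (lebesgue_power r) (edge_shell M r i j k l t)
    \<le> ennreal (shell_const DIM('a) (diameter M) * max 1 (measure lborel M) ^ r * t)"
proof -
  have sym: "edge_shell M r i j k l t = edge_shell M r i j l k t"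
    by (simp add: edge_shell_def norm_minus_commute)
  have "k \<notin> {i, j, l} \<or> l \<notin> {i, j, k}"
    using ne by auto
  then show ?thesis
    using emeasure_edge_shell_le_aux[OF M ran _ t]
      emeasure_edge_shell_le_aux[OF M ran(1,2,4,3) _ t] sym by auto
qed

section \<open>Measurability\<close>

text \<open>Outside \<open>{1..r}\<close> the coordinates are constantly \<open>undefined\<close> on
  the space. This makes open and closed sets of the full function space available for measurability
  proofs.\<close>

lemma inclusion_measurable:
  "(\<lambda>x. x) \<in> measurable (lebesgue_power r) (borel :: (nat \<Rightarrow> 'a::euclidean_space) measure)"
proof (rule measurable_coordinatewise_then_product)
  fix i show "(\<lambda>x. x i) \<in> borel_measurable (lebesgue_power r :: (nat \<Rightarrow> 'a) measure)"
  proof (cases "i \<in> {1..r}")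
    case False
    have "(\<lambda>x. undefined) \<in> borel_measurable (lebesgue_power r :: (nat \<Rightarrow> 'a) measure)"
      by simp
    then show ?thesis
      using False by (subst measurable_cong) (auto simp: space_lebesgue_power PiE_def extensional_def)
  qed (rule measurable_lebesgue_power_coordinate)
qed

lemma borel_Int_space_sets:
  fixes A :: "(nat \<Rightarrow> 'a::euclidean_space) set"
  assumes "A \<in> sets borel"
  shows "{x \<in> space (lebesgue_power r). x \<in> A} \<in> sets (lebesgue_power r)"
  using measurable_sets[OF inclusion_measurable assms, of r]
  by (simp add: vimage_def Int_def conj_commute)

text \<open>Tychonoff, with the singleton \<open>{undefined}\<close> as factor at every index
  outside \<open>{1..r}\<close>.\<close>

lemma compact_power_set_pts:
  fixes M :: "'a::euclidean_space set"
  assumes "compact M"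
  shows "compact (power_set_pts M r)"
proof -
  have "power_set_pts M r = PiE UNIV (\<lambda>i. if i \<in> {1..r} then M else {undefined})"
    by (auto simp: power_set_pts_def PiE_iff extensional_def split: if_splits)
  then show ?thesis
    using assms compactin_PiE[of "\<lambda>_. euclidean :: 'a topology" UNIV
        "\<lambda>i. if i \<in> {1..r} then M else {undefined}"]
    by (simp add: euclidean_product_topology)
qed

text \<open>By the tube lemma, a slice over \<open>x\<close> that misses \<open>T\<close> has a
  neighbourhood of slices missing \<open>T\<close>.\<close>

lemma closed_projection_compact:
  fixes T :: "('a::topological_space \<times> 'b::topological_space) set"
  assumes K: "compact K" and T: "closed T"
  shows "closed {x. \<exists>y\<in>K. (x, y) \<in> T}"
  unfolding closed_def
proof (subst open_subopen, intro ballI)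
  fix x assume "x \<in> - {x. \<exists>y\<in>K. (x, y) \<in> T}"
  then have "{x} \<times> K \<subseteq> - T" by auto
  from Elementary_Topology.tube_lemma[OF K _ this] T obtain X where "x \<in> X" "open X" "X \<times> K \<subseteq> - T"
    by auto
  then show "\<exists>X. open X \<and> x \<in> X \<and> X \<subseteq> - {x. \<exists>y\<in>K. (x, y) \<in> T}"
    by (intro exI[of _ X]) auto
qed

text \<open>The quantifier over \<open>y\<close> is a projection of a closed set along the compact
  set of configurations, hence closed in \<open>x\<close>. The strict inequality at \<open>x\<close>
  is a measurable condition.\<close>

lemma inversion_set_sets:
  fixes M :: "'a::euclidean_space set"
  assumes M: "compact M"
    and ran: "i \<in> {1..r}" "j \<in> {1..r}" "k \<in> {1..r}" "l \<in> {1..r}"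
  shows "inversion_set vr M r {i, j} {k, l} t \<in> sets (lebesgue_power r)"
proof -
  define T :: "((nat \<Rightarrow> 'a) \<times> (nat \<Rightarrow> 'a)) set" where
    "T = {p. (\<forall>m\<in>{1..r}. dist (fst p m) (snd p m) \<le> t) \<and>
       norm (snd p k - snd p l) \<le> norm (snd p i - snd p j)}"
  have coord: "continuous_on UNIV (\<lambda>p :: (nat \<Rightarrow> 'a) \<times> (nat \<Rightarrow> 'a). fst p m)"
    "continuous_on UNIV (\<lambda>p :: (nat \<Rightarrow> 'a) \<times> (nat \<Rightarrow> 'a). snd p m)" for m
    by (auto intro: continuous_on_product_then_coordinatewise[OF continuous_on_fst]
        continuous_on_product_then_coordinatewise[OF continuous_on_snd] continuous_on_id)
  have "T = (\<Inter>m\<in>{1..r}. {p. dist (fst p m) (snd p m) \<le> t}) \<inter>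
      {p. norm (snd p k - snd p l) \<le> norm (snd p i - snd p j)}"
    by (auto simp: T_def)
  also have "closed \<dots>"
    by (intro closed_Int closed_INT ballI closed_Collect_le continuous_on_dist continuous_on_norm
        continuous_on_diff continuous_on_const coord)
  finally have "closed T" .
  then have P: "closed {x. \<exists>y\<in>power_set_pts M r. (x, y) \<in> T}"
    using compact_power_set_pts[OF M] by (rule closed_projection_compact[rotated])
  have "inversion_set vr M r {i, j} {k, l} t =
      power_set_pts M r \<inter> {x \<in> space (lebesgue_power r). norm (x i - x j) < norm (x k - x l)}
      \<inter> {x \<in> space (lebesgue_power r). x \<in> {x. \<exists>y\<in>power_set_pts M r. (x, y) \<in> T}}"
    using power_set_pts_subset_space[of M r]
    by (auto simp: inversion_set_def ball_prod_def T_def vr_edge)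
  also have "\<dots> \<in> sets (lebesgue_power r)"
    by (intro sets.Int power_set_pts_sets borel_Int_space_sets borel_closed P borel_compact M
        borel_measurable_less measurable_edge_length ran)
  finally show ?thesis .
qed

text \<open>The condition inside the supremum of \<open>stability\<close>. Its symmetry and
  transitivity allow the reference point to be replaced by another one of the same type.\<close>

definition same_type ::
    "(nat set \<Rightarrow> (nat \<Rightarrow> 'a) \<Rightarrow> real) \<Rightarrow> nat \<Rightarrow> (nat \<Rightarrow> 'a) \<Rightarrow> (nat \<Rightarrow> 'a) \<Rightarrow> bool" where
  "same_type \<phi> r x y \<longleftrightarrow> num_levels \<phi> r x = num_levels \<phi> r y \<and>
     (\<forall>i\<in>{1..num_levels \<phi> r x}. minimal_faces \<phi> r x i = minimal_faces \<phi> r y i)"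

lemma same_type_trans: "same_type \<phi> r x y \<Longrightarrow> same_type \<phi> r y z \<Longrightarrow> same_type \<phi> r x z"
  by (auto simp: same_type_def)

lemma same_type_sym: "same_type \<phi> r x y \<Longrightarrow> same_type \<phi> r y x"
  by (auto simp: same_type_def)

lemma same_edge_order_imp_same_type: "same_edge_order r x y \<Longrightarrow> same_type vr r x y"
  unfolding same_type_def
  by (intro conjI ballI same_order_imp_same_levels same_edge_order_imp_vr_le_iff)

text \<open>The bound says that no radius above \<open>t\<close> is admissible. The radius
  \<open>t\<close> itself is not tested, since the supremum may be attained there.\<close>

lemma stability_le_iff:
  assumes "0 \<le> t"
  shows "stability \<phi> M r x \<le> ereal t \<longleftrightarrow>
    (\<forall>\<epsilon>>t. \<exists>y\<in>ball_prod M r x \<epsilon>. \<not> same_type \<phi> r x y)"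
proof -
  have "stability \<phi> M r x \<le> ereal t \<longleftrightarrow>
      (\<forall>\<epsilon>. 0 \<le> \<epsilon> \<and> (\<forall>y\<in>ball_prod M r x \<epsilon>. same_type \<phi> r x y) \<longrightarrow> \<epsilon> \<le> t)"
    by (auto simp: stability_def same_type_def Sup_le_iff)
  also have "\<dots> \<longleftrightarrow> (\<forall>\<epsilon>>t. \<exists>y\<in>ball_prod M r x \<epsilon>. \<not> same_type \<phi> r x y)"
    using assms by (meson not_le order_less_imp_le order_trans)
  finally show ?thesis .
qed

text \<open>
  On each of the finitely many cells \<open>{x. R x = S}\<close> the reference type is fixed, so instability at
  scale \<open>t\<close> is a countable intersection of open neighbourhoods of the points of other types.
\<close>

lemma unstable_set_sets:
  fixes M :: "'a::euclidean_space set"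
  assumes M: "compact M" and t: "0 \<le> t"
  shows "unstable_set vr M r t \<in> sets (lebesgue_power r)"
proof -
  define Q where "Q = {1..r} \<times> {1..r} \<times> {1..r} \<times> {1..r}"
  define R where "R x = {(i, j, k, l) \<in> Q. norm (x i - x j) \<le> norm (x k - x l)}" for x :: "nat \<Rightarrow> 'a"
  \<comment> \<open>The reference point \<open>z\<close> is decoupled from the centre
    \<open>x\<close>, and the strict distance bound makes the set open in \<open>x\<close>. The
    radii \<open>t + 1 / real (Suc n)\<close> replace all radii above \<open>t\<close>.\<close>
  define U where "U n z = {x. \<exists>y\<in>power_set_pts M r. \<not> same_type vr r z y \<and>
    (\<forall>m\<in>{1..r}. dist (x m) (y m) < t + 1 / real (Suc n))}" for n z
  have R_type: "same_type vr r x z" if "R x = R z" for x z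
  proof (rule same_edge_order_imp_same_type)
    have "(i, j, k, l) \<in> R x \<longleftrightarrow> (i, j, k, l) \<in> R z" for i j k l
      using that by simp
    then show "same_edge_order r x z"
      unfolding same_edge_order_def R_def Q_def by blast
  qed
  have unstable: "unstable_set vr M r t
      = power_set_pts M r \<inter> {x. \<forall>n. x \<in> U n x}"
  proof (intro set_eqI iffI)
    fix x assume x: "x \<in> unstable_set vr M r t"
    have "x \<in> U n x" for n
    proof -
      \<comment> \<open>The index is shifted by one so that the closed balls of this radius satisfy
        the strict bound in \<open>U n\<close>.\<close>
      have "t < t + 1 / real (Suc (Suc n))" by simp
      then obtain y where y: "y \<in> ball_prod M r x (t + 1 / real (Suc (Suc n)))"
          "\<not> same_type vr r x y"
        using x stability_le_iff[OF t, of vr M r x] unfolding unstable_set_def by blast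
      have "1 / real (Suc (Suc n)) < 1 / real (Suc n)"
        by (simp add: field_simps)
      with y show ?thesis
        unfolding U_def ball_prod_def by fastforce
    qed
    with x show "x \<in> power_set_pts M r \<inter> {x. \<forall>n. x \<in> U n x}"
      by (auto simp: unstable_set_def)
  next
    fix x assume x: "x \<in> power_set_pts M r \<inter> {x. \<forall>n. x \<in> U n x}"
    have "\<exists>y\<in>ball_prod M r x \<epsilon>. \<not> same_type vr r x y" if \<epsilon>: "t < \<epsilon>" for \<epsilon>
    proof -
      obtain n where "1 / real (Suc n) < \<epsilon> - t"
        using reals_Archimedean[of "\<epsilon> - t"] \<epsilon> by (auto simp: field_simps)
      moreover obtain y where "y \<in> power_set_pts M r" "\<not> same_type vr r x y"
          "\<forall>m\<in>{1..r}. dist (x m) (y m) < t + 1 / real (Suc n)"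
        using x by (auto simp: U_def)
      ultimately show ?thesis
        by (intro bexI[of _ y]) (auto simp: ball_prod_def)
    qed
    with x show "x \<in> unstable_set vr M r t"
      using stability_le_iff[OF t, of vr M r x] by (auto simp: unstable_set_def)
  qed
  have U_cong: "U n x = U n z" if "R x = R z" for n x z
    unfolding U_def using R_type[OF that] by (metis same_type_sym same_type_trans)
  have U_open: "open (U n z)" for n z
  proof -
    have "U n z = (\<Union>y\<in>{y\<in>power_set_pts M r. \<not> same_type vr r z y}.
        {x. \<forall>m\<in>{1..r}. dist (x m) (y m) < t + 1 / real (Suc n)})"
      by (auto simp: U_def)
    moreover have "open {x. \<forall>m\<in>{1..r}. dist (x m) (y m) < t + 1 / real (Suc n)}" for y :: "nat \<Rightarrow> 'a"
    proof -
      have "open (\<Inter>m\<in>{1..r}. {x. dist (x m) (y m) < t + 1 / real (Suc n)})"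
        by (intro open_INT ballI open_Collect_less continuous_on_dist continuous_on_const
            continuous_on_product_coordinates) simp
      moreover have "(\<Inter>m\<in>{1..r}. {x. dist (x m) (y m) < t + 1 / real (Suc n)})
          = {x. \<forall>m\<in>{1..r}. dist (x m) (y m) < t + 1 / real (Suc n)}"
        by auto
      ultimately show ?thesis by simp
    qed
    ultimately show ?thesis
      by auto
  qed
  have R_sets: "{x \<in> space (lebesgue_power r). R x = S} \<in> sets (lebesgue_power r)" if "S \<subseteq> Q" for S
  proof -
    have eq: "R x = S \<longleftrightarrow> (\<forall>i\<in>{1..r}. \<forall>j\<in>{1..r}. \<forall>k\<in>{1..r}. \<forall>l\<in>{1..r}.
        norm (x i - x j) \<le> norm (x k - x l) \<longleftrightarrow> (i, j, k, l) \<in> S)" for x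
      unfolding R_def using that by (auto simp: Q_def)
    have "{x \<in> space (lebesgue_power r). norm (x i - x j :: 'a) \<le> norm (x k - x l) \<longleftrightarrow> b}
        \<in> sets (lebesgue_power r)"
      if "i \<in> {1..r}" "j \<in> {1..r}" "k \<in> {1..r}" "l \<in> {1..r}" for i j k l b
      using that by (cases b) (simp_all only: eq_True eq_False not_le borel_measurable_le
          borel_measurable_less measurable_edge_length)
    then show ?thesis
      unfolding eq by (intro sets.sets_Collect_countable_All' countableI_type)
  qed
  \<comment> \<open>Choosing one representative per cell makes the open sets independent of
    \<open>x\<close>; by \<open>U_cong\<close> the choice is immaterial. Since \<open>S\<close>
    ranges over the image of \<open>R\<close>, a representative exists.\<close>
  have "unstable_set vr M r t = (\<Union>S\<in>R ` UNIV. power_set_pts M r \<inter>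
      {x \<in> space (lebesgue_power r). R x = S} \<inter>
      {x \<in> space (lebesgue_power r). x \<in> (\<Inter>n. U n (SOME z. R z = S))})"
  proof -
    have "U n (SOME z. R z = R x) = U n x" for n x
      by (intro U_cong) (rule someI[of "\<lambda>z. R z = R x" x], simp)
    then show ?thesis
      unfolding unstable using power_set_pts_subset_space[of M r] by auto (metis U_cong)
  qed
  also have "\<dots> \<in> sets (lebesgue_power r)"
  proof (intro sets.finite_UN)
    show "finite (range R)"
      by (rule finite_subset[of _ "Pow Q"]) (auto simp: R_def Q_def)
    fix S assume "S \<in> range R"
    then have "S \<subseteq> Q"
      by (auto simp: R_def)
    moreover have "(\<Inter>n. U n (SOME z. R z = S)) \<in> sets borel"
      by (intro sets.countable_INT) (auto intro: borel_open U_open)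
    ultimately show "power_set_pts M r \<inter> {x \<in> space (lebesgue_power r). R x = S} \<inter>
        {x \<in> space (lebesgue_power r). x \<in> (\<Inter>n. U n (SOME z. R z = S))}
        \<in> sets (lebesgue_power r)"
      by (intro sets.Int power_set_pts_sets[OF borel_compact[OF M]] borel_Int_space_sets R_sets)
  qed
  finally show ?thesis .
qed

section \<open>The volume bounds\<close>

text \<open>Ordered quadruples make the bound \<open>r ^ 4\<close> immediate. The case
  \<open>i = j\<close> is kept because it detects nearly coincident points.\<close>

definition edge_pairs :: "nat \<Rightarrow> (nat \<times> nat \<times> nat \<times> nat) set" where
  "edge_pairs r = {(i, j, k, l). {i, j, k, l} \<subseteq> {1..r} \<and> {i, j} \<noteq> {k, l} \<and> k \<noteq> l}"

lemma finite_edge_pairs: "finite (edge_pairs r)"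
  and card_edge_pairs_le: "card (edge_pairs r) \<le> r ^ 4"
proof -
  let ?P = "{1..r} \<times> {1..r} \<times> {1..r} \<times> {1..r}"
  have sub: "edge_pairs r \<subseteq> ?P"
    by (auto simp: edge_pairs_def)
  then show "finite (edge_pairs r)"
    by (rule finite_subset) simp
  have "card (edge_pairs r) \<le> card ?P"
    using sub by (intro card_mono) simp_all
  also have "\<dots> = r ^ 4"
    by (simp add: card_cartesian_product power4_eq_xxxx mult.assoc)
  finally show "card (edge_pairs r) \<le> r ^ 4" .
qed

lemma inversion_set_subset_edge_shell:
  assumes "i \<in> {1..r}" "j \<in> {1..r}" "k \<in> {1..r}" "l \<in> {1..r}"
  shows "inversion_set vr M r {i, j} {k, l} t \<subseteq> edge_shell M r i j k l t"
proof
  fix x assume x: "x \<in> inversion_set vr M r {i, j} {k, l} t"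
  then obtain y where y: "y \<in> ball_prod M r x t" "norm (y k - y l) \<le> norm (y i - y j)"
    by (auto simp: inversion_set_def vr_edge)
  from x edge_length_diff_le[OF y(1) assms(1,2)] edge_length_diff_le[OF y(1) assms(3,4)] y(2)
  show "x \<in> edge_shell M r i j k l t"
    by (auto simp: inversion_set_def vr_edge edge_shell_def)
qed

text \<open>Outside all shells every gap exceeds \<open>4 * t\<close> strictly. As there are
  finitely many gaps, all exceed \<open>4 * \<epsilon>\<close> for some \<open>\<epsilon>\<close>
  above \<open>t\<close>; then the type is constant on the product ball of radius
  \<open>\<epsilon>\<close>, contradicting instability at \<open>t\<close>.\<close>

lemma unstable_set_subset_edge_shells:
  assumes t: "0 \<le> t"
  shows "unstable_set vr M r t \<subseteq> (\<Union>(i, j, k, l)\<in>edge_pairs r. edge_shell M r i j k l t)"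
proof (rule ccontr)
  assume "\<not> ?thesis"
  then obtain x where x: "x \<in> unstable_set vr M r t"
    and "x \<notin> (\<Union>(i, j, k, l)\<in>edge_pairs r. edge_shell M r i j k l t)"
    by blast
  then have far: "x \<notin> edge_shell M r i j k l t" if "(i, j, k, l) \<in> edge_pairs r" for i j k l
    using that by fast
  let ?gap = "\<lambda>\<epsilon> (i, j, k, l). norm (x i - x j) \<le> norm (x k - x l) \<longrightarrow>
    norm (x i - x j) + 4 * \<epsilon> < norm (x k - x l)"
  \<comment> \<open>The right-neighbourhood filter at \<open>t\<close> replaces an explicit minimum
    over the gaps.\<close>
  have "\<forall>\<^sub>F \<epsilon> in at_right t. \<forall>q\<in>edge_pairs r. ?gap \<epsilon> q"
  proof (rule eventually_ball_finite)
    show "finite (edge_pairs r)"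
      by (rule finite_edge_pairs)
    show "\<forall>q\<in>edge_pairs r. \<forall>\<^sub>F \<epsilon> in at_right t. ?gap \<epsilon> q"
    proof
      fix q assume q: "q \<in> edge_pairs r"
      obtain i j k l where ijkl: "q = (i, j, k, l)"
        by (cases q) auto
      show "\<forall>\<^sub>F \<epsilon> in at_right t. ?gap \<epsilon> q"
      proof (cases "norm (x i - x j) \<le> norm (x k - x l)")
        case True
        have "x \<in> power_set_pts M r"
          using x by (simp add: unstable_set_def)
        with far[of i j k l] q True have "t < (norm (x k - x l) - norm (x i - x j)) / 4"
          unfolding ijkl edge_shell_def by auto
        then have "\<forall>\<^sub>F \<epsilon> in at_right t. \<epsilon> < (norm (x k - x l) - norm (x i - x j)) / 4"
          by (intro order_tendstoD[OF tendsto_ident_at])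
        then show ?thesis
          by eventually_elim (auto simp: ijkl)
      qed (simp add: ijkl)
    qed
  qed
  then have "\<forall>\<^sub>F \<epsilon> in at_right t. t < \<epsilon> \<and> (\<forall>q\<in>edge_pairs r. ?gap \<epsilon> q)"
    using eventually_at_right_less[of t] by eventually_elim simp
  then obtain \<epsilon> where \<epsilon>: "t < \<epsilon>" and gap: "\<forall>q\<in>edge_pairs r. ?gap \<epsilon> q"
    using eventually_happens[of _ "at_right t"] by auto
  obtain y where y: "y \<in> ball_prod M r x \<epsilon>" "\<not> same_type vr r x y"
    using x \<epsilon> stability_le_iff[OF t, of vr M r x] unfolding unstable_set_def by blast
  have "same_edge_order r x y"
  proof (rule separated_edges_imp_same_order[OF y(1)])
    fix i j k l assume "i \<in> {1..r}" "j \<in> {1..r}" "k \<in> {1..r}" "l \<in> {1..r}"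
      "{i, j} \<noteq> {k, l}" "k \<noteq> l" and le: "norm (x i - x j) \<le> norm (x k - x l)"
    then have "(i, j, k, l) \<in> edge_pairs r"
      by (simp add: edge_pairs_def)
    with gap le show "norm (x i - x j) + 4 * \<epsilon> < norm (x k - x l)"
      by blast
  qed (use t \<epsilon> in auto)
  with y(2) same_edge_order_imp_same_type show False
    by blast
qed

lemma volume_le_inversion_set:
  fixes M :: "'a::euclidean_space set"
  assumes M: "compact M" and ran: "i \<in> {1..r}" "j \<in> {1..r}" "k \<in> {1..r}" "l \<in> {1..r}"
    and ne: "{i, j} \<noteq> {k, l}" and t: "0 \<le> t" "t \<le> 1"
  shows "volume_le r (inversion_set vr M r {i, j} {k, l} t)
    (shell_const DIM('a) (diameter M) * max 1 (measure lborel M) ^ r * t)"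
  unfolding volume_le_def
proof
  show "inversion_set vr M r {i, j} {k, l} t \<in> sets (lebesgue_power r)"
    using M ran by (rule inversion_set_sets)
  show "emeasure (lebesgue_power r) (inversion_set vr M r {i, j} {k, l} t)
    \<le> ennreal (shell_const DIM('a) (diameter M) * max 1 (measure lborel M) ^ r * t)"
  proof (cases "k = l")
    \<comment> \<open>A degenerate second edge has length 0, and no length is strictly
      smaller.\<close>
    case True
    then have "inversion_set vr M r {i, j} {k, l} t = {}"
      unfolding inversion_set_def vr_edge by simp
    then show ?thesis by simp
  next
    case False
    have "emeasure (lebesgue_power r) (inversion_set vr M r {i, j} {k, l} t)
        \<le> emeasure (lebesgue_power r) (edge_shell M r i j k l t)"
      using ran M
      by (intro emeasure_mono inversion_set_subset_edge_shell edge_shell_sets borel_compact)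
    also note emeasure_edge_shell_le[OF M ran ne False t]
    finally show ?thesis .
  qed
qed

lemma volume_le_unstable_set:
  fixes M :: "'a::euclidean_space set"
  assumes M: "compact M" and t: "0 \<le> t" "t \<le> 1"
  shows "volume_le r (unstable_set vr M r t)
    (shell_const DIM('a) (diameter M) * max 1 (measure lborel M) ^ r * real r ^ 4 * t)"
  unfolding volume_le_def
proof
  show "unstable_set vr M r t \<in> sets (lebesgue_power r)"
    using M t(1) by (rule unstable_set_sets)
  let ?S = "\<lambda>(i, j, k, l). edge_shell M r i j k l t"
  define B where "B = shell_const DIM('a) (diameter M) * max 1 (measure lborel M) ^ r * t"
  have B: "0 \<le> B"
    using t M by (simp add: B_def shell_const_nonneg diameter_ge_0 compact_imp_bounded)
  have S: "?S q \<in> sets (lebesgue_power r)" "emeasure (lebesgue_power r) (?S q) \<le> ennreal B"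
    if "q \<in> edge_pairs r" for q
  proof -
    obtain i j k l where q: "q = (i, j, k, l)"
      by (cases q)
    with that have ran: "i \<in> {1..r}" "j \<in> {1..r}" "k \<in> {1..r}" "l \<in> {1..r}"
      and ne: "{i, j} \<noteq> {k, l}" "k \<noteq> l"
      by (simp_all add: edge_pairs_def)
    show "?S q \<in> sets (lebesgue_power r)"
      using edge_shell_sets[OF borel_compact[OF M] ran] by (simp add: q)
    show "emeasure (lebesgue_power r) (?S q) \<le> ennreal B"
      using emeasure_edge_shell_le[OF M ran ne t] by (simp add: q B_def)
  qed
  have "emeasure (lebesgue_power r) (unstable_set vr M r t)
      \<le> emeasure (lebesgue_power r) (\<Union>q\<in>edge_pairs r. ?S q)"
    using unstable_set_subset_edge_shells[OF t(1)] S(1) finite_edge_pairs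
    by (intro emeasure_mono sets.finite_UN)
  also have "\<dots> \<le> (\<Sum>q\<in>edge_pairs r. emeasure (lebesgue_power r) (?S q))"
    using S(1) finite_edge_pairs by (intro emeasure_subadditive_finite image_subsetI)
  also have "\<dots> \<le> (\<Sum>q\<in>edge_pairs r. ennreal B)"
    using S(2) by (rule sum_mono)
  also have "\<dots> = ennreal (real (card (edge_pairs r)) * B)"
    using B by (simp add: ennreal_mult ennreal_of_nat_eq_real_of_nat)
  also have "\<dots> \<le> ennreal (real r ^ 4 * B)"
    using B card_edge_pairs_le[of r] by (intro ennreal_leI mult_right_mono)
      (simp_all flip: of_nat_power)
  finally show "emeasure (lebesgue_power r) (unstable_set vr M r t)
    \<le> ennreal (shell_const DIM('a) (diameter M) * max 1 (measure lborel M) ^ r * real r ^ 4 * t)"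
    by (simp add: B_def mult_ac)
qed

theorem theorem2p4:
  shows
    "(\<exists>C\<^sub>V\<^sub>R :: real \<Rightarrow> real. \<forall>(M :: (real ^ 'n) set) (r :: nat). convex_body M \<longrightarrow>
        (\<forall>t\<in>{0..1}. \<forall>i\<in>{1..r}. \<forall>j\<in>{1..r}. \<forall>k\<in>{1..r}. \<forall>l\<in>{1..r}. {i, j} \<noteq> {k, l} \<longrightarrow>
           volume_le r (inversion_set vr M r {i, j} {k, l} t)
             (C\<^sub>V\<^sub>R (diameter M) * volume_factor M r * t)))
     \<and> (\<forall>(M :: (real ^ 'n) set) (r :: nat). convex_body M \<longrightarrow>
        (\<exists>C :: real. \<forall>t\<in>{0..1}. volume_le r (unstable_set vr M r t) (C * t)))
     \<and> (\<forall>M :: (real ^ 'n) set. convex_body M \<longrightarrow>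
        (\<exists>c :: real. \<forall>(r :: nat). \<forall>t\<in>{0..1}.
           volume_le r (unstable_set vr M r t) (c * volume_factor M r * real r ^ 4 * t)))"
\<comment> \<open>The constant of the first claim involves only the dimension and the
  diameter.\<close>
proof (intro conjI exI[of _ "shell_const DIM(real ^ 'n)"] allI impI ballI)
  fix M :: "(real ^ 'n) set" and r i j k l :: nat and t :: real
  assume "convex_body M" "t \<in> {0..1}" "i \<in> {1..r}" "j \<in> {1..r}" "k \<in> {1..r}" "l \<in> {1..r}"
    "{i, j} \<noteq> {k, l}"
  then show "volume_le r (inversion_set vr M r {i, j} {k, l} t)
      (shell_const DIM(real ^ 'n) (diameter M) * volume_factor M r * t)"
    unfolding volume_factor_def
    by (intro volume_le_inversion_set) (auto simp: convex_body_def)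
next
  fix M :: "(real ^ 'n) set" and r :: nat assume "convex_body M"
  then show "\<exists>C. \<forall>t\<in>{0..1}. volume_le r (unstable_set vr M r t) (C * t)"
    using volume_le_unstable_set[of M] unfolding convex_body_def by fastforce
next
  fix M :: "(real ^ 'n) set" assume "convex_body M"
  \<comment> \<open>The witness is \<open>shell_const\<close> at the diameter of \<open>M\<close>;
    all dependence on \<open>r\<close> is in \<open>volume_factor\<close> and
    \<open>real r ^ 4\<close>.\<close>
  then show "\<exists>c. \<forall>r. \<forall>t\<in>{0..1}.
      volume_le r (unstable_set vr M r t) (c * volume_factor M r * real r ^ 4 * t)"
    using volume_le_unstable_set[of M] unfolding convex_body_def volume_factor_def by fastforce
qed

end
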